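(* $=^{\mathrm{ce}}\ <_{\mathrm{Learn}}\ E^{\mathrm{ce}}_0$.
   Context: Fix a standard (acceptable) enumeration $(\varphi_e)_{e\in\omega}$ of the partial computable functions and let $W_e=\operatorname{dom}(\varphi_e)$. Write $e=^{\mathrm{ce}}e'$ iff $W_e=W_{e'}$, and $e\mathrel{E^{\mathrm{ce}}_0}e'$ iff the symmetric difference $W_e\mathbin{\triangle}W_{e'}$ is finite. An enumeration of a set $A$ is a surjection $\mu:\omega\to A$; $\mu[s]$ denotes the finite string $\mu(0),\dots,\mu(s-1)$. A learner is an arbitrary function $\mathbf{M}:\omega^{<\omega}\to\omega$ (no effectivity is assumed). For an equivalence relation $E^{\mathrm{ce}}$ on $\omega$ extending $=^{\mathrm{ce}}$, a family $\mathfrak{K}$ of nonempty c.e. sets is $E^{\mathrm{ce}}$-learnable if there is a learner $\mathbf{M}$ such that for every $e$ with $W_e\in\mathfrak{K}$ and every enumeration $\mu$ of $W_e$ there is $i\in\omega$ with $i\mathrel{E^{\mathrm{ce}}}e$ and $\mathbf{M}(\mu[s])=i$ for all sufficiently large $s$. $E^{\mathrm{ce}}\leq_{\mathrm{Learn}}F^{\mathrm{ce}}$ means that every $E^{\mathrm{ce}}$-learnable family of nonempty c.e. sets is also $F^{\mathrm{ce}}$-learnable; $E^{\mathrm{ce}}<_{\mathrm{Learn}}F^{\mathrm{ce}}$ means $E^{\mathrm{ce}}\leq_{\mathrm{Learn}}F^{\mathrm{ce}}$ and $F^{\mathrm{ce}}\not\leq_{\mathrm{Learn}}E^{\mathrm{ce}}$.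 *)

theory Defs
  imports Main
begin

text \<open>
  Partial computable functions are the partial recursive functions in the sense of Kleene.
  Terms carry no explicit arity: an argument tuple is a list, superfluous arguments are
  ignored, and projecting to a missing argument is undefined. On tuples of a fixed length this yields exactly the usual partial
  recursive functions of that arity.
\<close>

datatype recf =
    Zero
  | Succ
  | Proj nat
  | Comp recf "recf list"
  | PrimRec recf recf
  | Mu recf

fun eval :: "recf \<Rightarrow> nat list \<Rightarrow> nat option" where
  "eval Zero xs = Some 0"
| "eval Succ xs = (case xs of [] \<Rightarrow> None | x # _ \<Rightarrow> Some (Suc x))"
| "eval (Proj i) xs = (if i < length xs then Some (xs ! i) else None)"
| "eval (Comp f gs) xs =
    (if \<forall>g \<in> set gs. eval g xs \<noteq> None then eval f (map (\<lambda>g. the (eval g xs)) gs) else None)"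
| "eval (PrimRec f g) xs =
    (case xs of
       [] \<Rightarrow> None
     | n # ys \<Rightarrow>
         rec_nat (eval f ys) (\<lambda>m r. case r of None \<Rightarrow> None | Some y \<Rightarrow> eval g (m # y # ys)) n)"
| "eval (Mu f) xs =
    (if \<exists>n. eval f (n # xs) = Some 0 \<and> (\<forall>m<n. eval f (m # xs) \<noteq> None)
     then Some (LEAST n. eval f (n # xs) = Some 0) else None)"

definition partial_computable :: "(nat \<Rightarrow> nat option) \<Rightarrow> bool" where
  "partial_computable f \<longleftrightarrow> (\<exists>r. \<forall>x. f x = eval r [x])"

definition partial_computable2 :: "(nat \<Rightarrow> nat \<Rightarrow> nat option) \<Rightarrow> bool" where
  "partial_computable2 f \<longleftrightarrow> (\<exists>r. \<forall>x y. f x y = eval r [x, y])"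

definition total_computable :: "(nat \<Rightarrow> nat) \<Rightarrow> bool" where
  "total_computable f \<longleftrightarrow> partial_computable (\<lambda>x. Some (f x))"

text \<open>
  Acceptability in the sense of Rogers: the universal function is partial computable, and every
  computable family of partial computable functions is obtained through a computable reindexing
  (s-m-n property).
\<close>

definition acceptable :: "(nat \<Rightarrow> nat \<Rightarrow> nat option) \<Rightarrow> bool" where
  "acceptable \<phi> \<longleftrightarrow>
     range \<phi> = {f. partial_computable f} \<and>
     partial_computable2 \<phi> \<and>
     (\<forall>\<psi>. partial_computable2 \<psi> \<longrightarrow> (\<exists>s. total_computable s \<and> (\<forall>e. \<phi> (s e) = \<psi> e)))"

definition W :: "(nat \<Rightarrow> nat \<Rightarrow> nat option) \<Rightarrow> nat \<Rightarrow> nat set" where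
  "W \<phi> e = dom (\<phi> e)"

definition eq_ce :: "(nat \<Rightarrow> nat \<Rightarrow> nat option) \<Rightarrow> nat rel" where
  "eq_ce \<phi> = {(e, e'). W \<phi> e = W \<phi> e'}"

definition E0_ce :: "(nat \<Rightarrow> nat \<Rightarrow> nat option) \<Rightarrow> nat rel" where
  "E0_ce \<phi> = {(e, e'). finite (sym_diff (W \<phi> e) (W \<phi> e'))}"

definition enumeration_of :: "(nat \<Rightarrow> nat) \<Rightarrow> nat set \<Rightarrow> bool" where
  "enumeration_of \<mu> A \<longleftrightarrow> range \<mu> = A"

definition initial_string :: "(nat \<Rightarrow> nat) \<Rightarrow> nat \<Rightarrow> nat list" where
  "initial_string \<mu> s = map \<mu> [0..<s]"

definition nonempty_ce_family :: "(nat \<Rightarrow> nat \<Rightarrow> nat option) \<Rightarrow> nat set set \<Rightarrow> bool" where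
  "nonempty_ce_family \<phi> K \<longleftrightarrow> (\<forall>A \<in> K. A \<noteq> {} \<and> A \<in> range (W \<phi>))"

definition learnable :: "(nat \<Rightarrow> nat \<Rightarrow> nat option) \<Rightarrow> nat rel \<Rightarrow> nat set set \<Rightarrow> bool" where
  "learnable \<phi> E K \<longleftrightarrow>
     (\<exists>M :: nat list \<Rightarrow> nat. \<forall>e \<mu>. W \<phi> e \<in> K \<longrightarrow> enumeration_of \<mu> (W \<phi> e) \<longrightarrow>
        (\<exists>i. (i, e) \<in> E \<and> (\<exists>s0. \<forall>s\<ge>s0. M (initial_string \<mu> s) = i)))"

definition learn_le :: "(nat \<Rightarrow> nat \<Rightarrow> nat option) \<Rightarrow> nat rel \<Rightarrow> nat rel \<Rightarrow> bool" where
  "learn_le \<phi> E F \<longleftrightarrow>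
     (\<forall>K. nonempty_ce_family \<phi> K \<longrightarrow> learnable \<phi> E K \<longrightarrow> learnable \<phi> F K)"

definition learn_less :: "(nat \<Rightarrow> nat \<Rightarrow> nat option) \<Rightarrow> nat rel \<Rightarrow> nat rel \<Rightarrow> bool" where
  "learn_less \<phi> E F \<longleftrightarrow> learn_le \<phi> E F \<and> \<not> learn_le \<phi> F E"

end

theory Submission
  imports Defs "HOL-Library.Sublist"
begin

text \<open>
  The separating family consists of \<open>\<nat>\<close> and the sets \<open>\<nat> - {n}\<close>. All of them are
  \<open>E\<^sub>0\<close>-equivalent, so a constant learner succeeds. For equality, no finite subset of the naturals
  is a telltale: it is contained in some proper subset from the family. Hence any finite string
  can be extended so that the learner changes its mind, and iterating this while listing all
  numbers yields an enumeration on which the learner diverges.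
\<close>

text \<open>Testing for \<open>Suc n\<close> is testing the predecessor for \<open>n\<close>.
  Primitive recursion supplies the predecessor: \<open>Proj 0\<close> picks the recursion counter
  and the previous value is ignored, while the base case answers 0.\<close>

lemma eval_indicator:
  "\<exists>r. \<forall>x. eval r [x] = Some (if x = n then 1 else 0)"
proof (induction n)
  case 0
  have "eval (PrimRec (Comp Succ [Zero]) Zero) [x] = Some (if x = 0 then 1 else 0)" for x
    by (induction x) auto
  then show ?case by blast
next
  case (Suc n)
  then obtain r where r: "\<And>x. eval r [x] = Some (if x = n then 1 else 0)" by blast
  have "eval (PrimRec Zero (Comp r [Proj 0])) [x] = Some (if x = Suc n then 1 else 0)" for x
    by (induction x) (auto simp: r)
  then show ?case by blast
qed

lemma partial_computable_eval: "partial_computable (\<lambda>x. eval r [x])"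
  unfolding partial_computable_def by blast

lemma partial_computable_dom_Compl_singleton:
  "\<exists>f. partial_computable f \<and> dom f = - {n}"
proof -
  obtain r where r: "\<And>x. eval r [x] = Some (if x = n then 1 else 0)"
    using eval_indicator by blast
  \<comment> \<open>The searched function reads only \<open>x\<close>, since position 0 holds the
    search variable. So the search stops at once if the indicator is 0, that is
    \<open>x \<noteq> n\<close>, and never stops otherwise.\<close>
  have "dom (\<lambda>x. eval (Mu (Comp r [Proj 1])) [x]) = - {n}"
    by (simp add: r dom_def set_eq_iff)
  then show ?thesis using partial_computable_eval by metis
qed

lemma partial_computable_dom_UNIV: "\<exists>f. partial_computable f \<and> dom f = UNIV"
proof -
  have "dom (\<lambda>x. eval Zero [x]) = UNIV" by auto
  then show ?thesis using partial_computable_eval by metis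
qed

lemma acceptable_range_W:
  assumes "acceptable \<phi>" and "partial_computable f"
  shows "dom f \<in> range (W \<phi>)"
proof -
  obtain e where "f = \<phi> e" using assms unfolding acceptable_def by blast
  then show ?thesis by (auto simp: W_def)
qed

lemma learnable_mono:
  assumes "E \<subseteq> F" and "learnable \<phi> E K"
  shows "learnable \<phi> F K"
  using assms unfolding learnable_def by (meson subsetD)

lemma take_initial_string: "t \<le> s \<Longrightarrow> take t (initial_string \<mu> s) = initial_string \<mu> t"
  by (simp add: initial_string_def take_map)

lemma enumeration_extending:
  assumes "A \<noteq> {}" and "set \<sigma> \<subseteq> A"
  obtains \<mu> where "enumeration_of \<mu> A" and "initial_string \<mu> (length \<sigma>) = \<sigma>"
proof -
  obtain a where a: "a \<in> A" using assms by blast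
  \<comment> \<open>After \<sigma>, each x in A is listed at position
    \<open>length \<sigma> + x\<close>; the default \<open>a\<close> fills the positions belonging
    to non-elements. No computability is asked of \<mu>.\<close>
  define \<mu> where "\<mu> i = (if i < length \<sigma> then \<sigma> ! i
    else if i - length \<sigma> \<in> A then i - length \<sigma> else a)" for i
  have "\<mu> i \<in> A" for i
    using assms(2) a nth_mem[of i \<sigma>] by (auto simp: \<mu>_def)
  moreover have "\<mu> (length \<sigma> + x) = x" if "x \<in> A" for x
    using that by (simp add: \<mu>_def)
  ultimately have "range \<mu> = A" by (metis image_subset_iff rangeI subsetI subset_antisym)
  moreover have "initial_string \<mu> (length \<sigma>) = \<sigma>"
    by (rule nth_equalityI) (auto simp: initial_string_def \<mu>_def)
  ultimately show thesis using that by (simp add: enumeration_of_def)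
qed

text \<open>Strict growth forces \<open>\<sigma> (Suc i)\<close> to have an entry i, and coherence
  of the chain makes that entry the same in every string long enough to have it. These entries form
  the limit.\<close>

lemma prefix_chain_limit:
  fixes \<sigma> :: "nat \<Rightarrow> nat list"
  assumes step: "\<And>k. strict_prefix (\<sigma> k) (\<sigma> (Suc k))"
  obtains \<mu> where "\<And>k. initial_string \<mu> (length (\<sigma> k)) = \<sigma> k"
proof -
  have mono: "prefix (\<sigma> k) (\<sigma> l)" if "k \<le> l" for k l
    using that
  proof (induction rule: dec_induct)
    case (step l)
    then show ?case using prefix_order.trans prefix_order.less_imp_le[OF assms] by blast
  qed simp
  have len: "k \<le> length (\<sigma> k)" for k
  proof (induction k)
    case (Suc k)
    then show ?case using prefix_length_less[OF step[of k]] by linarith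
  qed simp
  have nth: "\<sigma> (Suc i) ! i = \<sigma> k ! i" if "i < length (\<sigma> k)" for i k
  proof (cases "k \<le> Suc i")
    case True
    then show ?thesis using mono[OF True] that by (auto simp: prefix_def nth_append)
  next
    case False
    then have "prefix (\<sigma> (Suc i)) (\<sigma> k)" using mono by simp
    then show ?thesis using len[of "Suc i"] by (auto simp: prefix_def nth_append)
  qed
  have "initial_string (\<lambda>i. \<sigma> (Suc i) ! i) (length (\<sigma> k)) = \<sigma> k" for k
    by (rule nth_equalityI) (auto simp: initial_string_def nth)
  then show thesis using that by blast
qed

text \<open>The necessity half of Angluin's telltale criterion, for arbitrary, possibly
  non-effective learners. The diagonalization is thereby kept apart from computability.\<close>

lemma no_telltale_imp_not_learnable:
  assumes ce: "nonempty_ce_family \<phi> K" and A: "A \<in> K"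
    and no_telltale: "\<And>D. finite D \<Longrightarrow> D \<subseteq> A \<Longrightarrow> \<exists>B\<in>K. D \<subseteq> B \<and> B \<subset> A"
  shows "\<not> learnable \<phi> (eq_ce \<phi>) K"
proof
  assume "learnable \<phi> (eq_ce \<phi>) K"
  then obtain M where M: "\<And>e \<mu>. W \<phi> e \<in> K \<Longrightarrow> enumeration_of \<mu> (W \<phi> e) \<Longrightarrow>
      \<exists>i. (i, e) \<in> eq_ce \<phi> \<and> (\<exists>s0. \<forall>s\<ge>s0. M (initial_string \<mu> s) = i)"
    unfolding learnable_def by blast
  have conv: "\<exists>i. W \<phi> i = B \<and> (\<exists>s0. \<forall>s\<ge>s0. M (initial_string \<mu> s) = i)"
    if "B \<in> K" "enumeration_of \<mu> B" for B \<mu>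
  proof -
    obtain e where "B = W \<phi> e" using ce \<open>B \<in> K\<close> unfolding nonempty_ce_family_def by blast
    then show ?thesis using M[of e \<mu>] that by (auto simp: eq_ce_def)
  qed
  \<comment> \<open>Completing \<sigma> to an enumeration of B and waiting for convergence yields
    the continuation \<tau>.\<close>
  have guess: "\<exists>\<tau>. set \<tau> \<subseteq> B \<and> W \<phi> (M (\<sigma> @ \<tau>)) = B" if B: "B \<in> K" and \<sigma>: "set \<sigma> \<subseteq> B" for B \<sigma>
  proof -
    have "B \<noteq> {}" using ce B unfolding nonempty_ce_family_def by blast
    then obtain \<mu> where \<mu>: "enumeration_of \<mu> B" "initial_string \<mu> (length \<sigma>) = \<sigma>"
      using enumeration_extending \<sigma> by blast
    obtain i s0 where i: "W \<phi> i = B" "\<And>s. s \<ge> s0 \<Longrightarrow> M (initial_string \<mu> s) = i"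
      using conv[OF B \<mu>(1)] by blast
    define s where "s = max s0 (length \<sigma>)"
    define \<tau> where "\<tau> = drop (length \<sigma>) (initial_string \<mu> s)"
    have \<sigma>\<tau>: "\<sigma> @ \<tau> = initial_string \<mu> s"
      using \<mu>(2) take_initial_string[of "length \<sigma>" s \<mu>]
      by (metis \<tau>_def append_take_drop_id max.cobounded2 s_def)
    have "set (initial_string \<mu> s) \<subseteq> B"
      using \<mu>(1) by (auto simp: enumeration_of_def initial_string_def)
    then have "set \<tau> \<subseteq> B" unfolding \<sigma>\<tau>[symmetric] by simp
    moreover have "W \<phi> (M (\<sigma> @ \<tau>)) = B" using i by (simp add: \<sigma>\<tau> s_def)
    ultimately show ?thesis by blast
  qed
  \<comment> \<open>The content of \<sigma> fits both A and a proper subset B from K. Continuations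
    that bring the learner to A and to B give different indices, so one of them differs from
    \<open>M \<sigma>\<close>; both stay inside A.\<close>
  have change: "\<exists>\<tau>. set \<tau> \<subseteq> A \<and> M (\<sigma> @ \<tau>) \<noteq> M \<sigma>" if \<sigma>: "set \<sigma> \<subseteq> A" for \<sigma>
  proof -
    obtain B where B: "B \<in> K" "set \<sigma> \<subseteq> B" "B \<subset> A"
      using no_telltale[OF finite_set \<sigma>] by blast
    obtain \<tau> \<tau>' where "set \<tau> \<subseteq> B" "W \<phi> (M (\<sigma> @ \<tau>)) = B"
      "set \<tau>' \<subseteq> A" "W \<phi> (M (\<sigma> @ \<tau>')) = A"
      using guess[OF B(1,2)] guess[OF A \<sigma>] by blast
    moreover from this have "M (\<sigma> @ \<tau>) \<noteq> M (\<sigma> @ \<tau>')" using B(3) by auto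
    ultimately show ?thesis using B(3) by (cases "M (\<sigma> @ \<tau>) = M \<sigma>") auto
  qed
  have "A \<noteq> {}" using ce A unfolding nonempty_ce_family_def by blast
  then obtain e where e: "enumeration_of e A" using enumeration_extending[of A "[]"] by auto
  \<comment> \<open>Each stage first forces a mind change by \<tau> and then appends
    \<open>e k\<close>. The appended entries make the limit exhaust A and also make the chain
    strict.\<close>
  obtain \<sigma> where sub: "\<And>k. set (\<sigma> k) \<subseteq> A"
    and step: "\<And>k. \<exists>\<tau>. \<sigma> (Suc k) = \<sigma> k @ \<tau> @ [e k] \<and> M (\<sigma> k @ \<tau>) \<noteq> M (\<sigma> k)"
  proof -
    have "\<exists>\<sigma>. \<forall>k. set (\<sigma> k) \<subseteq> A \<and>
        (\<exists>\<tau>. \<sigma> (Suc k) = \<sigma> k @ \<tau> @ [e k] \<and> M (\<sigma> k @ \<tau>) \<noteq> M (\<sigma> k))"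
    proof (rule dependent_nat_choice)
      show "\<exists>\<sigma>. set \<sigma> \<subseteq> A" by (rule exI[of _ "[]"]) simp
    next
      fix \<sigma> k assume \<sigma>: "set \<sigma> \<subseteq> A"
      then obtain \<tau> where "set \<tau> \<subseteq> A" "M (\<sigma> @ \<tau>) \<noteq> M \<sigma>" using change by blast
      moreover have "e k \<in> A" using e by (auto simp: enumeration_of_def)
      ultimately show "\<exists>\<rho>. set \<rho> \<subseteq> A \<and> (\<exists>\<tau>. \<rho> = \<sigma> @ \<tau> @ [e k] \<and> M (\<sigma> @ \<tau>) \<noteq> M \<sigma>)"
        using \<sigma> by (intro exI[of _ "\<sigma> @ \<tau> @ [e k]"]) auto
    qed
    then show thesis using that by blast
  qed
  have "strict_prefix (\<sigma> k) (\<sigma> (Suc k))" for k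
    using step[of k] by (auto simp: strict_prefix_def)
  then obtain \<mu> where \<mu>: "\<And>k. initial_string \<mu> (length (\<sigma> k)) = \<sigma> k"
    using prefix_chain_limit by blast
  have len: "k \<le> length (\<sigma> k)" for k
  proof (induction k)
    case (Suc k)
    moreover obtain \<tau> where "\<sigma> (Suc k) = \<sigma> k @ \<tau> @ [e k]" using step by blast
    ultimately show ?case by simp
  qed simp
  have "range \<mu> = A"
  proof
    show "range \<mu> \<subseteq> A"
    proof clarify
      fix i
      have "\<mu> i \<in> set (initial_string \<mu> (length (\<sigma> (Suc i))))"
        using len[of "Suc i"] by (auto simp: initial_string_def)
      then show "\<mu> i \<in> A" using \<mu> sub by auto
    qed
    show "A \<subseteq> range \<mu>"
    proof
      fix x assume "x \<in> A"
      then obtain k where "x = e k" using e unfolding enumeration_of_def by blast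
      then have "x \<in> set (initial_string \<mu> (length (\<sigma> (Suc k))))"
        using step[of k] \<mu>[of "Suc k"] by auto
      then show "x \<in> range \<mu>" by (auto simp: initial_string_def)
    qed
  qed
  then have "enumeration_of \<mu> A" by (simp add: enumeration_of_def)
  then obtain i s0 where s0: "\<And>s. s \<ge> s0 \<Longrightarrow> M (initial_string \<mu> s) = i"
    using conv[OF A] by blast
  \<comment> \<open>Stage \<open>s0\<close> suffices: \<open>\<sigma> s0\<close> has length at least
    \<open>s0\<close>, so the mind change happens after the supposed point of convergence. The
    string \<open>\<sigma> s0 @ \<tau>\<close> need not be in the chain, so it is recovered as an
    initial segment of \<mu> by truncating \<open>\<sigma> (Suc s0)\<close>.\<close>
  obtain \<tau> where \<tau>: "\<sigma> (Suc s0) = \<sigma> s0 @ \<tau> @ [e s0]" "M (\<sigma> s0 @ \<tau>) \<noteq> M (\<sigma> s0)"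
    using step by blast
  have "initial_string \<mu> (length (\<sigma> s0 @ \<tau>))
      = take (length (\<sigma> s0 @ \<tau>)) (initial_string \<mu> (length (\<sigma> (Suc s0))))"
    by (simp add: take_initial_string \<tau>(1))
  also have "\<dots> = \<sigma> s0 @ \<tau>" unfolding \<mu> by (simp add: \<tau>(1))
  finally have "initial_string \<mu> (length (\<sigma> s0 @ \<tau>)) = \<sigma> s0 @ \<tau>" .
  then have "M (\<sigma> s0 @ \<tau>) = i" using s0[of "length (\<sigma> s0 @ \<tau>)"] len[of s0] by simp
  moreover have "M (\<sigma> s0) = i" using s0[of "length (\<sigma> s0)"] len[of s0] \<mu> by simp
  ultimately show False using \<tau>(2) by simp
qed

text \<open>One fixed index \<open>u\<close> of \<open>UNIV\<close> is always a correct guess,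
  because the symmetric difference of \<open>UNIV\<close> and a set is its complement.\<close>

lemma learnable_E0_ce_of_cofinite:
  assumes "acceptable \<phi>" and "\<And>A. A \<in> K \<Longrightarrow> finite (- A)"
  shows "learnable \<phi> (E0_ce \<phi>) K"
proof -
  obtain u where "W \<phi> u = UNIV"
    using partial_computable_dom_UNIV acceptable_range_W[OF assms(1)] by (metis imageE)
  then have "(u, e) \<in> E0_ce \<phi>" if "W \<phi> e \<in> K" for e
    using assms(2)[OF that] by (simp add: E0_ce_def Compl_eq_Diff_UNIV)
  then show ?thesis unfolding learnable_def by (intro exI[of _ "\<lambda>_. u"]) blast
qed

theorem proposition5p1:
  fixes \<phi> :: "nat \<Rightarrow> nat \<Rightarrow> nat option"
  assumes "acceptable \<phi>"
  shows "learn_less \<phi> (eq_ce \<phi>) (E0_ce \<phi>)"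
proof -
  define K :: "nat set set" where "K = insert UNIV (range (\<lambda>n. - {n}))"
  have "UNIV \<in> range (W \<phi>)"
    using partial_computable_dom_UNIV acceptable_range_W[OF assms] by metis
  moreover have "- {n} \<in> range (W \<phi>)" for n
    using partial_computable_dom_Compl_singleton acceptable_range_W[OF assms] by metis
  moreover have "- {n} \<noteq> {}" for n :: nat
    by (metis ComplI empty_iff n_not_Suc_n singletonD)
  ultimately have ce: "nonempty_ce_family \<phi> K"
    by (auto simp: nonempty_ce_family_def K_def)
  have "\<exists>B\<in>K. D \<subseteq> B \<and> B \<subset> UNIV" if "finite D" for D
  proof -
    \<comment> \<open>Omitting a number outside D leaves a proper subset of \<open>UNIV\<close> that
      still contains D.\<close>
    obtain n where "n \<notin> D" using \<open>finite D\<close> ex_new_if_finite infinite_UNIV_nat by blast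
    then show ?thesis by (intro bexI[of _ "- {n}"]) (auto simp: K_def)
  qed
  then have "\<not> learnable \<phi> (eq_ce \<phi>) K"
    using ce by (intro no_telltale_imp_not_learnable[where A = UNIV]) (auto simp: K_def)
  moreover have "learnable \<phi> (E0_ce \<phi>) K"
    using assms by (rule learnable_E0_ce_of_cofinite) (auto simp: K_def)
  ultimately have "\<not> learn_le \<phi> (E0_ce \<phi>) (eq_ce \<phi>)"
    using ce unfolding learn_le_def by blast
  \<comment> \<open>Equal sets have empty symmetric difference, so a learner that is correct up to
    equality is correct up to finite difference without modification.\<close>
  moreover have "eq_ce \<phi> \<subseteq> E0_ce \<phi>" by (auto simp: eq_ce_def E0_ce_def)
  then have "learn_le \<phi> (eq_ce \<phi>) (E0_ce \<phi>)"
    unfolding learn_le_def using learnable_mono by blast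
  ultimately show ?thesis by (simp add: learn_less_def)
qed

end
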